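(* Let $m$ be a positive even integer and $n$ a positive integer. Then both $HPSD(m,n)$ and $HSOS(m,n)$ are closed convex cones in $\mathbb{R}^{(n-1)m+1}$.
   Context: For $\mathbf{x}=(x_0,\dots,x_p)^\top$ and $\mathbf{y}=(y_0,\dots,y_q)^\top$ real vectors, the convolution $\mathbf{x}*\mathbf{y}\in\mathbb{R}^{p+q+1}$ has entries $(\mathbf{x}*\mathbf{y})_i=\sum_{i_1+i_2=i,\,0\le i_1\le p,\,0\le i_2\le q}x_{i_1}y_{i_2}$, $i=0,\dots,p+q$ (the coefficient vector of the product of the polynomials with coefficient vectors $\mathbf{x}$ and $\mathbf{y}$). For $\mathbf{x}\in\mathbb{R}^n$, $\mathbf{x}^{*m}=\mathbf{x}*\cdots*\mathbf{x}$ ($m$ factors) $\in\mathbb{R}^{(n-1)m+1}$. The symbol $\bullet$ denotes the standard inner product. For $\mathbf{v}\in\mathbb{R}^{(n-1)m+1}$, the Hankel form generated by $\mathbf{v}$ is the homogeneous polynomial $H(\mathbf{x})=\mathbf{v}\bullet\mathbf{x}^{*m}$ of degree $m$ in $\mathbf{x}\in\mathbb{R}^n$. For $m=2k$ even: $H$ is PSD if $H(\mathbf{x})\ge 0$ for all $\mathbf{x}\in\mathbb{R}^n$; $H$ is SOS if it is a finite sum of squares of real homogeneous polynomials of degree $k$ in $\mathbf{x}$. Define $HPSD(m,n)=\{\mathbf{v}\in\mathbb{R}^{(n-1)m+1}: \mathbf{v}\bullet\mathbf{x}^{*m}\text{ is PSD}\}$ and $HSOS(m,n)=\{\mathbf{v}\in\mathbb{R}^{(n-1)m+1}: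 \mathbf{v}\bullet\mathbf{x}^{*m}\text{ is SOS}\}$. *)

theory Defs
  imports "HOL-Analysis.Analysis" "HOL-Library.Function_Algebras"
begin

text \<open>
  A vector of \<open>\<real>\<^sup>d\<close> is a function \<open>nat \<Rightarrow> real\<close> (entries indexed from 0) that vanishes at all
  indices \<open>\<ge> d\<close>, i.e. a point of the library's topological space \<^const>\<open>Euclidean_space\<close>\<open> d\<close>.
  Function_Algebras supplies pointwise addition; the instance below adds pointwise scaling, so
  that \<^const>\<open>convex_cone\<close> applies to sets of such vectors.
\<close>

instantiation "fun" :: (type, real_vector) real_vector
begin

definition scaleR_fun :: "real \<Rightarrow> ('a \<Rightarrow> 'b) \<Rightarrow> 'a \<Rightarrow> 'b" where
  "scaleR_fun c f = (\<lambda>i. c *\<^sub>R f i)"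

instance
  by standard (simp_all add: scaleR_fun_def fun_eq_iff algebra_simps)

end

text \<open>Convolution of \<open>(x\<^sub>0, \<dots>, x\<^sub>p)\<close> and \<open>(y\<^sub>0, \<dots>, y\<^sub>q)\<close>; the entries at indices \<open>> p + q\<close> are
  empty sums.\<close>

definition conv :: "nat \<Rightarrow> nat \<Rightarrow> (nat \<Rightarrow> real) \<Rightarrow> (nat \<Rightarrow> real) \<Rightarrow> nat \<Rightarrow> real" where
  "conv p q x y i = (\<Sum>(i1, i2) \<in> {(i1, i2). i1 \<le> p \<and> i2 \<le> q \<and> i1 + i2 = i}. x i1 * y i2)"

text \<open>For \<open>x \<in> \<real>\<^sup>n\<close> with \<open>n \<ge> 1\<close>, the \<open>m\<close>-fold convolution \<open>x * \<dots> * x\<close>, which has last index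
  \<open>(n - 1) * m\<close>; for \<open>m = 0\<close> it is the unit of convolution.\<close>

fun conv_power :: "nat \<Rightarrow> (nat \<Rightarrow> real) \<Rightarrow> nat \<Rightarrow> nat \<Rightarrow> real" where
  "conv_power n x 0 = (\<lambda>i. if i = 0 then 1 else 0)"
| "conv_power n x (Suc m) = conv ((n - 1) * m) (n - 1) (conv_power n x m) x"

definition hankel_dim :: "nat \<Rightarrow> nat \<Rightarrow> nat" where
  "hankel_dim m n = (n - 1) * m + 1"

definition hankel_form :: "nat \<Rightarrow> nat \<Rightarrow> (nat \<Rightarrow> real) \<Rightarrow> (nat \<Rightarrow> real) \<Rightarrow> real" where
  "hankel_form m n v x = (\<Sum>i < hankel_dim m n. v i * conv_power n x m i)"

text \<open>Real polynomials in the variables \<open>x\<^sub>0, \<dots>, x\<^bsub>n-1\<^esub>\<close> are identified with the functions they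
  induce, which is harmless over the infinite field of real numbers.\<close>

definition multi_indices :: "nat \<Rightarrow> nat \<Rightarrow> (nat \<Rightarrow> nat) set" where
  "multi_indices n k = {\<alpha>. (\<forall>i\<ge>n. \<alpha> i = 0) \<and> (\<Sum>i<n. \<alpha> i) = k}"

lemma finite_multi_indices: "finite (multi_indices n k)"
proof -
  have "multi_indices n k
      \<subseteq> {\<alpha>. \<forall>i. (i \<in> {..<n} \<longrightarrow> \<alpha> i \<in> {..k}) \<and> (i \<notin> {..<n} \<longrightarrow> \<alpha> i = 0)}"
    by (auto simp: multi_indices_def intro: member_le_sum)
  then show ?thesis
    by (rule finite_subset) (intro finite_set_of_finite_funs finite_lessThan finite_atMost)
qed

definition homogeneous_poly :: "nat \<Rightarrow> nat \<Rightarrow> ((nat \<Rightarrow> real) \<Rightarrow> real) \<Rightarrow> bool" where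
  "homogeneous_poly n k q \<longleftrightarrow>
     (\<exists>c. q = (\<lambda>x. \<Sum>\<alpha>\<in>multi_indices n k. c \<alpha> * (\<Prod>i<n. x i ^ \<alpha> i)))"

definition PSD :: "nat \<Rightarrow> ((nat \<Rightarrow> real) \<Rightarrow> real) \<Rightarrow> bool" where
  "PSD n H \<longleftrightarrow> (\<forall>x \<in> topspace (Euclidean_space n). H x \<ge> 0)"

text \<open>For a form \<open>H\<close> of degree \<open>2 * k\<close> in \<open>n\<close> variables.\<close>

definition SOS :: "nat \<Rightarrow> nat \<Rightarrow> ((nat \<Rightarrow> real) \<Rightarrow> real) \<Rightarrow> bool" where
  "SOS n k H \<longleftrightarrow>
     (\<exists>qs. (\<forall>q \<in> set qs. homogeneous_poly n k q) \<and>
           (\<forall>x \<in> topspace (Euclidean_space n). H x = (\<Sum>q\<leftarrow>qs. (q x)\<^sup>2)))"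

definition HPSD :: "nat \<Rightarrow> nat \<Rightarrow> (nat \<Rightarrow> real) set" where
  "HPSD m n = {v \<in> topspace (Euclidean_space (hankel_dim m n)). PSD n (hankel_form m n v)}"

definition HSOS :: "nat \<Rightarrow> nat \<Rightarrow> (nat \<Rightarrow> real) set" where
  "HSOS m n =
     {v \<in> topspace (Euclidean_space (hankel_dim m n)). SOS n (m div 2) (hankel_form m n v)}"

end

theory Submission
  imports Defs
begin

text \<open>
  Membership in either set is a condition on the form \<open>x \<mapsto> v \<bullet> x\<^sup>*\<^sup>m\<close>, which is linear in \<open>v\<close> and, at
  each \<open>x\<close>, continuous in \<open>v\<close>. So it suffices that PSD and SOS functions form cones that are
  closed under pointwise limits. Only the limits of SOS functions need work: write a sum of squares
  by its Gram matrix in the monomial basis. The coefficients of a form are fixed linear combinations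
  of its values on a grid, so pointwise convergence bounds the Gram matrices; a subsequence converges
  to a positive semidefinite matrix representing the limit, and a Cholesky decomposition of that
  matrix turns it back into a sum of squares.
\<close>

section \<open>Positive semidefinite matrices over a finite index set\<close>

text \<open>An arbitrary index set lets multi-indices label rows and columns directly, with no
  enumeration. Only the values of \<open>y\<close> on \<open>A\<close> enter the form.\<close>

definition psd_on :: "'a set \<Rightarrow> ('a \<Rightarrow> 'a \<Rightarrow> real) \<Rightarrow> bool" where
  "psd_on A G \<longleftrightarrow> (\<forall>a\<in>A. \<forall>b\<in>A. G a b = G b a) \<and>
     (\<forall>y. 0 \<le> (\<Sum>a\<in>A. \<Sum>b\<in>A. y a * y b * G a b))"

lemma psd_on_sym: "psd_on A G \<Longrightarrow> a \<in> A \<Longrightarrow> b \<in> A \<Longrightarrow> G a b = G b a"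
  by (auto simp: psd_on_def)

lemma psd_on_nonneg: "psd_on A G \<Longrightarrow> 0 \<le> (\<Sum>a\<in>A. \<Sum>b\<in>A. y a * y b * G a b)"
  by (auto simp: psd_on_def)

lemma square_sum: "(\<Sum>a\<in>A. f a)\<^sup>2 = (\<Sum>a\<in>A. \<Sum>b\<in>A. f a * f b)" for f :: "'a \<Rightarrow> real"
  by (simp add: power2_eq_square sum_product)

text \<open>Interchanging the sums separates the squares. With arbitrary \<open>y\<close> this makes
  Gram matrices positive semidefinite; with \<open>y\<close> the vector of monomials it turns a Gram
  matrix into a sum of squares of polynomials.\<close>

lemma sum_gram:
  fixes c :: "nat \<Rightarrow> 'a \<Rightarrow> real"
  shows "(\<Sum>a\<in>A. \<Sum>b\<in>A. y a * y b * (\<Sum>l<N. c l a * c l b)) = (\<Sum>l<N. (\<Sum>a\<in>A. c l a * y a)\<^sup>2)"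
proof -
  have "(\<Sum>a\<in>A. \<Sum>b\<in>A. y a * y b * (\<Sum>l<N. c l a * c l b))
      = (\<Sum>a\<in>A. \<Sum>b\<in>A. \<Sum>l<N. (c l a * y a) * (c l b * y b))"
    by (simp add: sum_distrib_left mult_ac)
  also have "\<dots> = (\<Sum>a\<in>A. \<Sum>l<N. \<Sum>b\<in>A. (c l a * y a) * (c l b * y b))"
    by (intro sum.cong refl) (rule sum.swap)
  also have "\<dots> = (\<Sum>l<N. \<Sum>a\<in>A. \<Sum>b\<in>A. (c l a * y a) * (c l b * y b))"
    by (rule sum.swap)
  finally show ?thesis
    by (simp add: square_sum)
qed

lemma psd_on_gram: "psd_on A (\<lambda>a b. \<Sum>l<N. c l a * c l b)" for c :: "nat \<Rightarrow> 'a \<Rightarrow> real"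
  unfolding psd_on_def sum_gram by (auto simp: mult.commute sum_nonneg)

text \<open>Evaluate the form at the vector with entry \<open>s\<close> at \<open>a\<close> and
  \<open>y\<close> on \<open>A\<close>; symmetry merges the two cross terms. The free
  \<open>s\<close> is then specialised to obtain the facts on pivots below.\<close>

lemma psd_on_insert_form:
  assumes "finite A" "a \<notin> A" "psd_on (insert a A) G"
  shows "0 \<le> s\<^sup>2 * G a a + 2 * s * (\<Sum>b\<in>A. y b * G a b) + (\<Sum>b\<in>A. \<Sum>c\<in>A. y b * y c * G b c)"
proof -
  define z where "z = y(a := s)"
  have z: "z a = s" "\<And>b. b \<in> A \<Longrightarrow> z b = y b"
    using assms(2) by (auto simp: z_def)
  have "(\<Sum>b\<in>insert a A. \<Sum>c\<in>insert a A. z b * z c * G b c)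
      = (s * s * G a a + (\<Sum>c\<in>A. s * y c * G a c)) +
        ((\<Sum>b\<in>A. y b * s * G b a) + (\<Sum>b\<in>A. \<Sum>c\<in>A. y b * y c * G b c))"
    using assms(1,2) by (simp add: z sum.distrib cong: sum.cong)
  also have "(\<Sum>b\<in>A. y b * s * G b a) = (\<Sum>b\<in>A. s * y b * G a b)"
    using psd_on_sym[OF assms(3)] by (intro sum.cong) auto
  also have "(\<Sum>b\<in>A. s * y b * G a b) = s * (\<Sum>b\<in>A. y b * G a b)"
    by (simp add: sum_distrib_left mult_ac)
  finally show ?thesis
    using psd_on_nonneg[OF assms(3), of z] by (simp add: power2_eq_square algebra_simps)
qed

text \<open>The Schur complement step of a Cholesky decomposition. If the pivot \<open>G a a\<close> is zero, the
  division yields \<open>0\<close>, which is the right value since the whole row then vanishes.\<close>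

lemma psd_on_schur_complement:
  assumes "finite A" "a \<notin> A" "psd_on (insert a A) G"
  shows "psd_on A (\<lambda>b c. G b c - G a b * G a c / G a a)"
  unfolding psd_on_def
proof (intro conjI ballI allI)
  fix b c assume "b \<in> A" "c \<in> A"
  then show "G b c - G a b * G a c / G a a = G c b - G a c * G a b / G a a"
    using psd_on_sym[OF assms(3), of b c] by simp
next
  fix y :: "'a \<Rightarrow> real"
  define L where "L = (\<Sum>b\<in>A. y b * G a b)"
  have "(\<Sum>b\<in>A. \<Sum>c\<in>A. y b * y c * (G b c - G a b * G a c / G a a))
      = (\<Sum>b\<in>A. \<Sum>c\<in>A. y b * y c * G b c) - (\<Sum>b\<in>A. \<Sum>c\<in>A. (y b * G a b) * (y c * G a c)) / G a a"
    by (simp add: right_diff_distrib sum_subtractf sum_divide_distrib mult_ac)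
  also have "(\<Sum>b\<in>A. \<Sum>c\<in>A. (y b * G a b) * (y c * G a c)) = L\<^sup>2"
    by (simp add: L_def square_sum)
  also have "0 \<le> (\<Sum>b\<in>A. \<Sum>c\<in>A. y b * y c * G b c) - L\<^sup>2 / G a a"
    \<comment> \<open>For a positive pivot this \<open>s\<close> minimises the quadratic in
      \<open>s\<close>. For a zero pivot it is 0, since division by 0 gives 0, and only the form on
      \<open>A\<close> remains.\<close>
    using psd_on_insert_form[OF assms, of "- L / G a a" y]
    by (cases "G a a = 0") (simp_all add: L_def[symmetric] power2_eq_square field_simps)
  finally show "0 \<le> (\<Sum>b\<in>A. \<Sum>c\<in>A. y b * y c * (G b c - G a b * G a c / G a a))" .
qed

lemma psd_on_diag_nonneg:
  assumes "finite A" "a \<notin> A" "psd_on (insert a A) G"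
  shows "0 \<le> G a a"
  using psd_on_insert_form[OF assms, of 1 "\<lambda>_. 0"] by simp

text \<open>At the unit vector of \<open>b\<close> the form is affine in \<open>s\<close> with slope
  \<open>2 * G a b\<close>; being nonnegative for every \<open>s\<close>, it must have slope
  0.\<close>

lemma psd_on_zero_diag:
  assumes "finite A" "a \<notin> A" "psd_on (insert a A) G" and "G a a = 0" and b: "b \<in> A"
  shows "G a b = 0"
proof (rule ccontr)
  assume nz: "G a b \<noteq> 0"
  define e where "e c = (if c = b then 1 else 0 :: real)" for c
  have lin: "(\<Sum>c\<in>A. e c * f c) = f b" for f
    using b assms(1) by (simp add: e_def if_distrib if_distribR cong: if_cong)
  have "(\<Sum>b'\<in>A. \<Sum>c\<in>A. e b' * e c * G b' c) = G b b"
    by (simp add: mult.assoc sum_distrib_left[symmetric] lin)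
  then have "0 \<le> 2 * s * G a b + G b b" for s
    using psd_on_insert_form[OF assms(1-3), of s e] assms(4) by (simp add: lin)
  \<comment> \<open>At this \<open>s\<close> the affine function takes the value -1.\<close>
  from this[of "- (G b b + 1) / (2 * G a b)"] nz show False
    by (simp add: field_simps)
qed

text \<open>Induction on the index set: factor the Schur complement, then add one vector that
  accounts for the pivot row.\<close>

lemma psd_on_imp_gram:
  assumes "finite A" "psd_on A G"
  shows "\<exists>N c. \<forall>a\<in>A. \<forall>b\<in>A. G a b = (\<Sum>l<(N::nat). c l a * c l b :: real)"
  using assms
proof (induction A arbitrary: G rule: finite_induct)
  case empty
  then show ?case by auto
next
  case (insert a A)
  obtain N :: nat and c where c:
    "\<forall>p\<in>A. \<forall>q\<in>A. G p q - G a p * G a q / G a a = (\<Sum>l<N. c l p * c l q)"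
    using insert.IH[OF psd_on_schur_complement[OF insert.hyps insert.prems]]
    by (elim exE) (rule that)
  \<comment> \<open>Vector number \<open>N\<close> is the pivot row divided by the root of the pivot
    (zero if the pivot is zero); the earlier vectors are extended by 0 at \<open>a\<close>.\<close>
  define d where
    "d l p = (if l = N then G a p / sqrt (G a a) else if p = a then 0 else c l p)" for l p
  have diag: "0 \<le> G a a"
    by (rule psd_on_diag_nonneg[OF insert.hyps insert.prems])
  have split: "(\<Sum>l<Suc N. d l p * d l q) =
      (if p = a \<or> q = a then 0 else \<Sum>l<N. c l p * c l q) + G a p * G a q / G a a" for p q
    using diag by (auto simp: d_def)
  have "G p q = (\<Sum>l<Suc N. d l p * d l q)" if "p \<in> insert a A" "q \<in> insert a A" for p q
  proof (cases "p = a \<or> q = a")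
    case True
    \<comment> \<open>A nonzero pivot cancels; with a zero pivot the whole row of \<open>a\<close>
      vanishes, so both sides are 0.\<close>
    have "G a p * G a q / G a a = G p q"
      using True that psd_on_sym[OF insert.prems that]
        psd_on_zero_diag[OF insert.hyps insert.prems] by (cases "G a a = 0") auto
    then show ?thesis
      unfolding split using True by simp
  next
    case False
    then show ?thesis
      unfolding split using that c by (simp add: algebra_simps)
  qed
  then show ?case by blast
qed

section \<open>Recovering coefficients from values\<close>

text \<open>The weight \<open>w t\<close> is the coefficient of degree \<open>i\<close> in the
  Lagrange basis polynomial of the node \<open>t\<close> among 0, ..., k.\<close>

lemma coeff_extraction_univariate:
  "\<exists>w :: nat \<Rightarrow> real. \<forall>j\<le>k. (\<Sum>t\<le>k. w t * real t ^ j) = (if j = i then 1 else 0)"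
proof -
  define L :: "nat \<Rightarrow> real poly" where
    "L t = (\<Prod>s\<in>{..k} - {t}. smult (1 / (real t - real s)) [:- real s, 1:])" for t
  have degL: "degree (L t) \<le> k" if "t \<le> k" for t
  proof -
    have "degree (L t) \<le> (\<Sum>s\<in>{..k} - {t}. degree (smult (1 / (real t - real s)) [:- real s, 1:]))"
      unfolding L_def by (rule degree_prod_sum_le[unfolded o_def]) auto
    also have "\<dots> \<le> (\<Sum>s\<in>{..k} - {t}. 1)"
      by (intro sum_mono order_trans[OF degree_smult_le]) simp
    finally show ?thesis using that by simp
  qed
  have polyL: "poly (L t) (real s) = (if s = t then 1 else 0)" if "s \<le> k" for s t
  proof (cases "s = t")
    case True
    then show ?thesis
      by (auto simp: L_def poly_prod simp flip: diff_divide_distrib intro!: prod.neutral)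
  next
    case False
    then show ?thesis
      using that by (auto simp: L_def poly_prod)
  qed
  have "(\<Sum>t\<le>k. coeff (L t) i * real t ^ j) = (if j = i then 1 else 0)" if "j \<le> k" for j
  proof -
    \<comment> \<open>Lagrange interpolation: both sides have degree at most \<open>k\<close> and
      agree at \<open>k + 1\<close> nodes.\<close>
    have "monom 1 j = (\<Sum>t\<le>k. smult (real t ^ j) (L t))"
    proof (rule poly_eqI_degree[where A = "real ` {..k}"])
      show "poly (monom 1 j) x = poly (\<Sum>t\<le>k. smult (real t ^ j) (L t)) x"
        if "x \<in> real ` {..k}" for x
        using that by (auto simp: poly_monom poly_sum polyL if_distrib cong: if_cong)
      have "card (real ` {..k}) = Suc k" by (simp add: card_image)
      moreover have "degree (\<Sum>t\<le>k. smult (real t ^ j) (L t)) \<le> k"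
        by (intro degree_sum_le) (auto intro: order_trans[OF degree_smult_le] degL)
      ultimately show "degree (monom (1::real) j) < card (real ` {..k})"
        "degree (\<Sum>t\<le>k. smult (real t ^ j) (L t)) < card (real ` {..k})"
        using that by (auto simp: degree_monom_eq)
    qed
    then have "coeff (monom (1::real) j) i = (\<Sum>t\<le>k. real t ^ j * coeff (L t) i)"
      by (simp add: coeff_sum)
    then show ?thesis
      by (simp add: mult.commute)
  qed
  then show ?thesis
    by (intro exI[of _ "\<lambda>t. coeff (L t) i"]) simp
qed

lemma multi_indices_le: "\<alpha> \<in> multi_indices n k \<Longrightarrow> i < n \<Longrightarrow> \<alpha> i \<le> k"
  using member_le_sum[of i "{..<n}" \<alpha>] by (auto simp: multi_indices_def)

lemma multi_indices_eqI:
  assumes "\<alpha> \<in> multi_indices n k" "\<beta> \<in> multi_indices n k" "\<And>i. i < n \<Longrightarrow> \<alpha> i = \<beta> i"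
  shows "\<alpha> = \<beta>"
proof
  show "\<alpha> i = \<beta> i" for i
    using assms by (cases "i < n") (auto simp: multi_indices_def)
qed

text \<open>Tensor product of the univariate extraction functionals, evaluated on the grid
  \<open>{0, \<dots>, k}\<^sup>n\<close>.\<close>

lemma coeff_extraction:
  assumes \<alpha>: "\<alpha> \<in> multi_indices n k"
  shows "\<exists>X w. finite X \<and> X \<subseteq> topspace (Euclidean_space n) \<and>
    (\<forall>c. c \<alpha> = (\<Sum>x\<in>X. w x * (\<Sum>\<beta>\<in>multi_indices n k. c \<beta> * (\<Prod>i<n. x i ^ \<beta> i)) :: real))"
proof -
  obtain u :: "nat \<Rightarrow> nat \<Rightarrow> real" where u:
    "\<And>i j. j \<le> k \<Longrightarrow> (\<Sum>t\<le>k. u i t * real t ^ j) = (if j = i then 1 else 0)"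
    using coeff_extraction_univariate[of k] by metis
  define P where "P = ({..<n} \<rightarrow>\<^sub>E {..k})"
  define pt where "pt g i = (if i < n then real (g i) else 0)" for g i
  have finP: "finite P" unfolding P_def by (intro finite_PiE) auto
  have inj: "inj_on pt P"
  proof (rule inj_onI)
    fix g h assume gh: "g \<in> P" "h \<in> P" "pt g = pt h"
    have "g i = h i" if "i < n" for i
      using fun_cong[OF gh(3), of i] that by (simp add: pt_def)
    then show "g = h"
      using gh(1,2) unfolding P_def by (intro PiE_ext) auto
  qed
  \<comment> \<open>Weights are attached to points rather than to grid indices, hence the inverse of
    \<open>pt\<close>; values off the grid are irrelevant.\<close>
  define w where "w x = (\<Prod>i<n. u (\<alpha> i) (the_inv_into P pt x i))" for x
  have wpt: "w (pt g) = (\<Prod>i<n. u (\<alpha> i) (g i))" if "g \<in> P" for g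
    by (simp add: w_def the_inv_into_f_f[OF inj that])
  have mono: "(\<Sum>g\<in>P. w (pt g) * (\<Prod>i<n. pt g i ^ \<beta> i)) = (if \<beta> = \<alpha> then 1 else 0)"
    if \<beta>: "\<beta> \<in> multi_indices n k" for \<beta>
  proof -
    have "(\<Sum>g\<in>P. w (pt g) * (\<Prod>i<n. pt g i ^ \<beta> i)) = (\<Sum>g\<in>P. \<Prod>i<n. u (\<alpha> i) (g i) * real (g i) ^ \<beta> i)"
      by (intro sum.cong refl) (simp add: wpt prod.distrib pt_def)
    \<comment> \<open>Summing a product of one-coordinate factors over the grid factorises, which
      leaves a univariate extraction in each coordinate.\<close>
    also have "\<dots> = (\<Prod>i<n. \<Sum>t\<le>k. u (\<alpha> i) t * real t ^ \<beta> i)"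
      unfolding P_def by (subst prod_sum_PiE) auto
    also have "\<dots> = (\<Prod>i<n. if \<beta> i = \<alpha> i then 1 else 0)"
      using multi_indices_le[OF \<beta>] by (intro prod.cong refl) (simp add: u)
    also have "\<dots> = (if \<beta> = \<alpha> then 1 else 0)"
      using multi_indices_eqI[OF \<beta> \<alpha>] by (auto intro!: prod_zero)
    finally show ?thesis .
  qed
  have "c \<alpha> = (\<Sum>x\<in>pt ` P. w x * (\<Sum>\<beta>\<in>multi_indices n k. c \<beta> * (\<Prod>i<n. x i ^ \<beta> i)))" for c
  proof -
    have "(\<Sum>x\<in>pt ` P. w x * (\<Sum>\<beta>\<in>multi_indices n k. c \<beta> * (\<Prod>i<n. x i ^ \<beta> i)))
        = (\<Sum>g\<in>P. \<Sum>\<beta>\<in>multi_indices n k. c \<beta> * (w (pt g) * (\<Prod>i<n. pt g i ^ \<beta> i)))"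
      by (simp add: sum.reindex[OF inj] sum_distrib_left mult_ac)
    also have "\<dots> = (\<Sum>\<beta>\<in>multi_indices n k. c \<beta> * (\<Sum>g\<in>P. w (pt g) * (\<Prod>i<n. pt g i ^ \<beta> i)))"
      by (subst sum.swap) (simp add: sum_distrib_left)
    also have "\<dots> = (\<Sum>\<beta>\<in>multi_indices n k. if \<beta> = \<alpha> then c \<beta> else 0)"
      by (intro sum.cong refl) (simp add: mono)
    also have "\<dots> = c \<alpha>"
      using \<alpha> by (simp add: finite_multi_indices)
    finally show ?thesis by simp
  qed
  moreover have "pt ` P \<subseteq> topspace (Euclidean_space n)"
    by (auto simp: topspace_Euclidean_space pt_def)
  ultimately show ?thesis
    using finP by blast
qed

section \<open>Sums of squares and their limits\<close>

text \<open>Replaces the list of polynomials by an indexed family of coefficient vectors, from which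
  a Gram matrix can be formed.\<close>

lemma SOS_iff_coeffs:
  "SOS n k H \<longleftrightarrow> (\<exists>N c. \<forall>x \<in> topspace (Euclidean_space n).
     H x = (\<Sum>l<(N::nat). (\<Sum>\<alpha>\<in>multi_indices n k. c l \<alpha> * (\<Prod>i<n. x i ^ \<alpha> i))\<^sup>2))"
  (is "_ \<longleftrightarrow> ?R")
proof
  assume "SOS n k H"
  then obtain qs where qs: "\<forall>q \<in> set qs. homogeneous_poly n k q"
    and H: "\<forall>x \<in> topspace (Euclidean_space n). H x = (\<Sum>q\<leftarrow>qs. (q x)\<^sup>2)"
    by (auto simp: SOS_def)
  from qs have "\<forall>l<length qs. \<exists>c. qs ! l = (\<lambda>x. \<Sum>\<alpha>\<in>multi_indices n k. c \<alpha> * (\<Prod>i<n. x i ^ \<alpha> i))"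
    by (auto simp: homogeneous_poly_def)
  then obtain c where c: "\<And>l. l < length qs \<Longrightarrow>
      qs ! l = (\<lambda>x. \<Sum>\<alpha>\<in>multi_indices n k. c l \<alpha> * (\<Prod>i<n. x i ^ \<alpha> i))"
    by metis
  have "(\<Sum>q\<leftarrow>qs. (q x)\<^sup>2)
      = (\<Sum>l<length qs. (\<Sum>\<alpha>\<in>multi_indices n k. c l \<alpha> * (\<Prod>i<n. x i ^ \<alpha> i))\<^sup>2)" for x
    by (simp add: sum_list_sum_nth atLeast0LessThan c)
  with H show ?R
    by (intro exI[of _ "length qs"] exI[of _ c]) simp
next
  assume ?R
  then obtain N c where H: "\<forall>x \<in> topspace (Euclidean_space n).
      H x = (\<Sum>l<(N::nat). (\<Sum>\<alpha>\<in>multi_indices n k. c l \<alpha> * (\<Prod>i<n. x i ^ \<alpha> i))\<^sup>2)"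
    by (elim exE) (rule that)
  define qs where
    "qs = map (\<lambda>l x. \<Sum>\<alpha>\<in>multi_indices n k. c l \<alpha> * (\<Prod>i<n. x i ^ \<alpha> i)) [0..<N]"
  have "\<forall>q \<in> set qs. homogeneous_poly n k q"
    by (auto simp: qs_def homogeneous_poly_def)
  moreover have "\<forall>x \<in> topspace (Euclidean_space n). H x = (\<Sum>q\<leftarrow>qs. (q x)\<^sup>2)"
    using H by (simp add: qs_def sum_list_sum_nth atLeast0LessThan)
  ultimately show "SOS n k H"
    unfolding SOS_def by blast
qed

text \<open>One direction forms the Gram matrix of the coefficient vectors, the other factors it
  again. The size of \<open>G\<close> depends only on \<open>n\<close> and \<open>k\<close>, however
  many squares there are, which is what makes compactness applicable.\<close>

lemma SOS_iff_gram:
  "SOS n k H \<longleftrightarrow> (\<exists>G. psd_on (multi_indices n k) G \<and>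
     (\<forall>x \<in> topspace (Euclidean_space n). H x =
       (\<Sum>\<alpha>\<in>multi_indices n k. \<Sum>\<beta>\<in>multi_indices n k.
          (\<Prod>i<n. x i ^ \<alpha> i) * (\<Prod>i<n. x i ^ \<beta> i) * G \<alpha> \<beta>)))"
  (is "_ \<longleftrightarrow> ?R")
proof
  assume "SOS n k H"
  then obtain N c where "\<forall>x \<in> topspace (Euclidean_space n).
      H x = (\<Sum>l<(N::nat). (\<Sum>\<alpha>\<in>multi_indices n k. c l \<alpha> * (\<Prod>i<n. x i ^ \<alpha> i))\<^sup>2)"
    unfolding SOS_iff_coeffs by (elim exE) (rule that)
  then show ?R
    using psd_on_gram[where A = "multi_indices n k" and N = N and c = c]
    by (intro exI[of _ "\<lambda>\<alpha> \<beta>. \<Sum>l<N. c l \<alpha> * c l \<beta>"]) (simp add: sum_gram)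
next
  assume ?R
  then obtain G where G: "psd_on (multi_indices n k) G" and
    H: "\<forall>x \<in> topspace (Euclidean_space n). H x =
       (\<Sum>\<alpha>\<in>multi_indices n k. \<Sum>\<beta>\<in>multi_indices n k.
          (\<Prod>i<n. x i ^ \<alpha> i) * (\<Prod>i<n. x i ^ \<beta> i) * G \<alpha> \<beta>)"
    by blast
  obtain N c where c: "\<forall>\<alpha>\<in>multi_indices n k. \<forall>\<beta>\<in>multi_indices n k.
      G \<alpha> \<beta> = (\<Sum>l<(N::nat). c l \<alpha> * c l \<beta>)"
    using psd_on_imp_gram[OF finite_multi_indices G] by (elim exE) (rule that)
  have "\<forall>x \<in> topspace (Euclidean_space n).
      H x = (\<Sum>l<N. (\<Sum>\<alpha>\<in>multi_indices n k. c l \<alpha> * (\<Prod>i<n. x i ^ \<alpha> i))\<^sup>2)"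
    using H c by (simp flip: sum_gram)
  then show "SOS n k H"
    unfolding SOS_iff_coeffs by (intro exI)
qed

section \<open>Bounds on Gram matrices and limits of sums of squares\<close>

text \<open>Bolzano-Weierstrass for finitely many coordinates simultaneously, so that one
  subsequence serves all matrix entries.\<close>

lemma finite_family_convergent_subsequence:
  fixes f :: "nat \<Rightarrow> 'a \<Rightarrow> real"
  assumes D: "finite D" and bdd: "\<And>d. d \<in> D \<Longrightarrow> bounded (range (\<lambda>j. f j d))"
  obtains r g where "strict_mono (r :: nat \<Rightarrow> nat)" "\<And>d. d \<in> D \<Longrightarrow> (\<lambda>j. f (r j) d) \<longlonglongrightarrow> g d"
proof -
  obtain l r where r: "strict_mono (r :: nat \<Rightarrow> nat)"
    and l: "\<forall>e>0. \<forall>\<^sub>F j in sequentially. \<forall>d\<in>D. dist (f (r j) d) (l d) < e"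
    using compact_lemma_general[of D "\<lambda>h d. h d" f "\<lambda>h. h"] D bdd
    by (auto simp: image_image)
  have "(\<lambda>j. f (r j) d) \<longlonglongrightarrow> l d" if "d \<in> D" for d
  proof (rule tendstoI)
    fix e :: real assume "e > 0"
    with l have "\<forall>\<^sub>F j in sequentially. \<forall>d\<in>D. dist (f (r j) d) (l d) < e" by blast
    then show "\<forall>\<^sub>F j in sequentially. dist (f (r j) d) (l d) < e"
      by eventually_elim (use that in blast)
  qed
  with r that show thesis by blast
qed

text \<open>Termwise from 2|uv| \<le> u^2 + v^2; it reduces bounding all entries of a Gram matrix to
  bounding its diagonal.\<close>

lemma gram_entry_bound:
  fixes u v :: "'a \<Rightarrow> real"
  shows "\<bar>\<Sum>l\<in>A. u l * v l\<bar> \<le> (\<Sum>l\<in>A. (u l)\<^sup>2) + (\<Sum>l\<in>A. (v l)\<^sup>2)"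
proof -
  have "\<bar>u l * v l\<bar> \<le> (u l)\<^sup>2 + (v l)\<^sup>2" for l
  proof -
    have "2 * (\<bar>u l\<bar> * \<bar>v l\<bar>) \<le> (u l)\<^sup>2 + (v l)\<^sup>2"
      using sum_squares_bound[of "\<bar>u l\<bar>" "\<bar>v l\<bar>"] by simp
    moreover have "0 \<le> \<bar>u l\<bar> * \<bar>v l\<bar>" by simp
    ultimately show ?thesis unfolding abs_mult by linarith
  qed
  then have "(\<Sum>l\<in>A. \<bar>u l * v l\<bar>) \<le> (\<Sum>l\<in>A. (u l)\<^sup>2 + (v l)\<^sup>2)"
    by (intro sum_mono) simp
  then show ?thesis
    using sum_abs[of "\<lambda>l. u l * v l" A] unfolding sum.distrib by linarith
qed

text \<open>Since each coefficient of \<open>q\<close> is a combination of values of \<open>q\<close>, pointwise bounds on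
  \<open>\<Sum>q\<^sup>2\<close> bound the diagonal of its Gram matrix.\<close>

lemma sum_square_coeffs_bound:
  assumes \<alpha>: "\<alpha> \<in> multi_indices n k"
  obtains X w where "finite X" "X \<subseteq> topspace (Euclidean_space n)"
    "\<And>(N::nat) c. (\<Sum>l<N. (c l \<alpha>)\<^sup>2) \<le> (\<Sum>x\<in>X. w x *
       (\<Sum>l<N. (\<Sum>\<beta>\<in>multi_indices n k. c l \<beta> * (\<Prod>i<n. x i ^ \<beta> i))\<^sup>2))"
proof -
  obtain X w where X: "finite X" "X \<subseteq> topspace (Euclidean_space n)" and w:
    "\<And>c. c \<alpha> = (\<Sum>x\<in>X. w x * (\<Sum>\<beta>\<in>multi_indices n k. c \<beta> * (\<Prod>i<n. x i ^ \<beta> i)) :: real)"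
    using coeff_extraction[OF \<alpha>] by blast
  \<comment> \<open>The extraction weights get squared, and Cauchy-Schwarz over \<open>X\<close>
    costs the factor \<open>card X\<close>. The new weights do not depend on \<open>N\<close> or
    \<open>c\<close>, so the bound is uniform in the number of squares.\<close>
  have "(\<Sum>l<N. (c l \<alpha>)\<^sup>2) \<le> (\<Sum>x\<in>X. (card X * (w x)\<^sup>2) *
       (\<Sum>l<N. (\<Sum>\<beta>\<in>multi_indices n k. c l \<beta> * (\<Prod>i<n. x i ^ \<beta> i))\<^sup>2))"
    for N :: nat and c
  proof -
    define q where "q l x = (\<Sum>\<beta>\<in>multi_indices n k. c l \<beta> * (\<Prod>i<n. x i ^ \<beta> i))" for l x
    have "(c l \<alpha>)\<^sup>2 \<le> (\<Sum>x\<in>X. (w x * q l x)\<^sup>2) * card X" for l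
      using sum_squared_le_sum_of_squares[of "\<lambda>x. w x * q l x" X]
      by (subst w) (simp add: q_def)
    then have "(\<Sum>l<N. (c l \<alpha>)\<^sup>2) \<le> (\<Sum>l<N. \<Sum>x\<in>X. (card X * (w x)\<^sup>2) * (q l x)\<^sup>2)"
      by (intro sum_mono) (simp add: sum_distrib_left power_mult_distrib mult_ac)
    also have "\<dots> = (\<Sum>x\<in>X. (card X * (w x)\<^sup>2) * (\<Sum>l<N. (q l x)\<^sup>2))"
      by (subst sum.swap) (simp add: sum_distrib_left)
    finally show ?thesis by (simp add: q_def)
  qed
  with X show thesis by (rule that)
qed

lemma SOS_limit:
  assumes SOS: "\<And>j. SOS n k (H j)"
    and lim: "\<And>x. x \<in> topspace (Euclidean_space n) \<Longrightarrow> (\<lambda>j. H j x) \<longlonglongrightarrow> H' x"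
  shows "SOS n k H'"
proof -
  let ?M = "multi_indices n k" and ?T = "topspace (Euclidean_space n)"
  let ?mon = "\<lambda>x \<alpha>. \<Prod>i<n. (x i :: real) ^ \<alpha> i"
  have "\<forall>j. \<exists>N c. \<forall>x\<in>?T. H j x = (\<Sum>l<(N::nat). (\<Sum>\<alpha>\<in>?M. c l \<alpha> * ?mon x \<alpha>)\<^sup>2)"
    using SOS unfolding SOS_iff_coeffs by (rule allI)
  then obtain N c where
    "\<forall>j. \<forall>x\<in>?T. H j x = (\<Sum>l<(N j :: nat). (\<Sum>\<alpha>\<in>?M. c j l \<alpha> * ?mon x \<alpha>)\<^sup>2)"
    unfolding choice_iff by (elim exE) (rule that)
  then have H: "H j x = (\<Sum>l<N j. (\<Sum>\<alpha>\<in>?M. c j l \<alpha> * ?mon x \<alpha>)\<^sup>2)" if "x \<in> ?T" for j x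
    using that by blast
  \<comment> \<open>Indexing by pairs makes the entries a single finite family, to which the
    subsequence lemma applies.\<close>
  define G where "G j p = (\<Sum>l<N j. c j l (fst p) * c j l (snd p))" for j p
  have HG: "H j x = (\<Sum>\<alpha>\<in>?M. \<Sum>\<beta>\<in>?M. ?mon x \<alpha> * ?mon x \<beta> * G j (\<alpha>, \<beta>))"
    if "x \<in> ?T" for j x
    by (simp add: H[OF that] G_def sum_gram)
  have psdG: "psd_on ?M (\<lambda>\<alpha> \<beta>. G j (\<alpha>, \<beta>))" for j
    by (simp add: G_def psd_on_gram)
  have "\<exists>B. \<forall>j. (\<Sum>l<N j. (c j l \<alpha>)\<^sup>2) \<le> B" if \<alpha>: "\<alpha> \<in> ?M" for \<alpha>
  proof -
    obtain X w where X: "finite X" "X \<subseteq> ?T" and w: "\<And>(N::nat) c. (\<Sum>l<N. (c l \<alpha>)\<^sup>2) \<le>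
        (\<Sum>x\<in>X. w x * (\<Sum>l<N. (\<Sum>\<beta>\<in>?M. c l \<beta> * ?mon x \<beta>)\<^sup>2))"
      using sum_square_coeffs_bound[OF \<alpha>] by blast
    \<comment> \<open>The diagonal entry is dominated by a fixed finite combination of values of
      \<open>H j\<close>; this converges, hence is bounded in \<open>j\<close>.\<close>
    have "(\<lambda>j. \<Sum>x\<in>X. w x * H j x) \<longlonglongrightarrow> (\<Sum>x\<in>X. w x * H' x)"
      using X by (intro tendsto_intros lim) auto
    then have "bounded (range (\<lambda>j. \<Sum>x\<in>X. w x * H j x))"
      by (rule convergent_imp_bounded)
    then obtain B where B: "\<And>j. \<bar>\<Sum>x\<in>X. w x * H j x\<bar> \<le> B"
      by (auto simp: bounded_iff)
    have "(\<Sum>l<N j. (c j l \<alpha>)\<^sup>2) \<le> B" for j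
    proof -
      have "(\<Sum>l<N j. (c j l \<alpha>)\<^sup>2) \<le> (\<Sum>x\<in>X. w x * H j x)"
        using w[of "c j" "N j"] X(2) by (simp add: H subset_iff cong: sum.cong)
      with B[of j] show ?thesis by linarith
    qed
    then show ?thesis by blast
  qed
  then obtain B where B: "\<And>\<alpha> j. \<alpha> \<in> ?M \<Longrightarrow> (\<Sum>l<N j. (c j l \<alpha>)\<^sup>2) \<le> B \<alpha>"
    by metis
  have "bounded (range (\<lambda>j. G j p))" if "p \<in> ?M \<times> ?M" for p
  proof -
    have "\<bar>G j p\<bar> \<le> B (fst p) + B (snd p)" for j
      using gram_entry_bound[of "\<lambda>l. c j l (fst p)" "\<lambda>l. c j l (snd p)" "{..<N j}"]
        B[of "fst p" j] B[of "snd p" j] that by (auto simp: G_def)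
    then show ?thesis by (auto simp: bounded_iff)
  qed
  then obtain r G' where r: "strict_mono (r :: nat \<Rightarrow> nat)"
    and G': "\<And>p. p \<in> ?M \<times> ?M \<Longrightarrow> (\<lambda>j. G (r j) p) \<longlonglongrightarrow> G' p"
    using finite_family_convergent_subsequence[of "?M \<times> ?M" G] finite_multi_indices by blast
  \<comment> \<open>Used twice: arbitrary \<open>y\<close> shows that the limit matrix is positive
    semidefinite, and the monomial vector at \<open>x\<close> shows that it represents
    \<open>H'\<close>.\<close>
  have form: "(\<lambda>j. \<Sum>\<alpha>\<in>?M. \<Sum>\<beta>\<in>?M. y \<alpha> * y \<beta> * G (r j) (\<alpha>, \<beta>))
      \<longlonglongrightarrow> (\<Sum>\<alpha>\<in>?M. \<Sum>\<beta>\<in>?M. y \<alpha> * y \<beta> * G' (\<alpha>, \<beta>))" for y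
    by (intro tendsto_intros G') auto
  have "psd_on ?M (\<lambda>\<alpha> \<beta>. G' (\<alpha>, \<beta>))"
    unfolding psd_on_def
  proof (intro conjI ballI allI)
    fix \<alpha> \<beta> assume \<alpha>\<beta>: "\<alpha> \<in> ?M" "\<beta> \<in> ?M"
    have "(\<lambda>j. G (r j) (\<alpha>, \<beta>)) = (\<lambda>j. G (r j) (\<beta>, \<alpha>))"
      by (simp add: G_def mult.commute)
    then show "G' (\<alpha>, \<beta>) = G' (\<beta>, \<alpha>)"
      using G'[of "(\<alpha>, \<beta>)"] G'[of "(\<beta>, \<alpha>)"] \<alpha>\<beta> by (auto intro: LIMSEQ_unique)
  next
    show "0 \<le> (\<Sum>\<alpha>\<in>?M. \<Sum>\<beta>\<in>?M. y \<alpha> * y \<beta> * G' (\<alpha>, \<beta>))" for y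
      by (rule LIMSEQ_le_const[OF form]) (use psd_on_nonneg[OF psdG] in blast)
  qed
  moreover have "H' x = (\<Sum>\<alpha>\<in>?M. \<Sum>\<beta>\<in>?M. ?mon x \<alpha> * ?mon x \<beta> * G' (\<alpha>, \<beta>))" if "x \<in> ?T" for x
    using LIMSEQ_subseq_LIMSEQ[OF lim[OF that] r] form[of "?mon x"]
    by (simp add: HG[OF that] o_def LIMSEQ_unique)
  ultimately show ?thesis
    unfolding SOS_iff_gram by (intro exI[of _ "\<lambda>\<alpha> \<beta>. G' (\<alpha>, \<beta>)"]) blast
qed

section \<open>Cone operations on sums of squares\<close>

lemma homogeneous_poly_scale:
  assumes "homogeneous_poly n k q"
  shows "homogeneous_poly n k (\<lambda>x. t * q x)"
proof -
  obtain c where "q = (\<lambda>x. \<Sum>\<alpha>\<in>multi_indices n k. c \<alpha> * (\<Prod>i<n. x i ^ \<alpha> i))"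
    using assms by (auto simp: homogeneous_poly_def)
  then show ?thesis
    unfolding homogeneous_poly_def
    by (intro exI[of _ "\<lambda>\<alpha>. t * c \<alpha>"]) (simp add: sum_distrib_left mult.assoc)
qed

lemma SOS_zero: "SOS n k (\<lambda>_. 0)"
  unfolding SOS_def by (intro exI[of _ "[]"]) simp

lemma SOS_add:
  assumes "SOS n k F" "SOS n k H"
  shows "SOS n k (\<lambda>x. F x + H x)"
proof -
  obtain qs rs where "\<forall>q \<in> set qs. homogeneous_poly n k q" "\<forall>q \<in> set rs. homogeneous_poly n k q"
    "\<forall>x \<in> topspace (Euclidean_space n). F x = (\<Sum>q\<leftarrow>qs. (q x)\<^sup>2)"
    "\<forall>x \<in> topspace (Euclidean_space n). H x = (\<Sum>q\<leftarrow>rs. (q x)\<^sup>2)"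
    using assms by (auto simp: SOS_def)
  then show ?thesis
    unfolding SOS_def by (intro exI[of _ "qs @ rs"]) auto
qed

text \<open>The factor \<open>t\<close> is absorbed into each square as
  \<open>sqrt t\<close>.\<close>

lemma SOS_scale:
  assumes "SOS n k H" "0 \<le> t"
  shows "SOS n k (\<lambda>x. t * H x)"
proof -
  obtain qs where "\<forall>q \<in> set qs. homogeneous_poly n k q"
    "\<forall>x \<in> topspace (Euclidean_space n). H x = (\<Sum>q\<leftarrow>qs. (q x)\<^sup>2)"
    using assms(1) by (auto simp: SOS_def)
  with \<open>0 \<le> t\<close> show ?thesis
    unfolding SOS_def
    by (intro exI[of _ "map (\<lambda>q x. sqrt t * q x) qs"])
      (auto simp: homogeneous_poly_scale o_def power_mult_distrib sum_list_const_mult)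
qed

section \<open>Hankel forms\<close>

lemma hankel_form_zero: "hankel_form m n 0 = (\<lambda>_. 0)"
  by (simp add: hankel_form_def fun_eq_iff)

lemma hankel_form_add: "hankel_form m n (u + v) = (\<lambda>x. hankel_form m n u x + hankel_form m n v x)"
  by (simp add: hankel_form_def fun_eq_iff distrib_right sum.distrib)

lemma hankel_form_scaleR: "hankel_form m n (t *\<^sub>R v) = (\<lambda>x. t * hankel_form m n v x)"
  by (simp add: hankel_form_def fun_eq_iff scaleR_fun_def sum_distrib_left mult.assoc)

text \<open>Convergence in the product topology gives convergence of every coordinate, and the form
  is a finite linear combination of coordinates.\<close>

lemma hankel_form_tendsto:
  assumes "v \<longlonglongrightarrow> l"
  shows "(\<lambda>j. hankel_form m n (v j) x) \<longlonglongrightarrow> hankel_form m n l x"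
proof -
  have "(\<lambda>j. v j i) \<longlonglongrightarrow> l i" for i
    using continuous_on_tendsto_compose[OF continuous_on_product_coordinates assms] by simp
  then show ?thesis
    unfolding hankel_form_def by (intro tendsto_intros)
qed

text \<open>The form depends linearly on \<open>v\<close>, so cone properties of \<open>P\<close>
  pull back to the generating vectors.\<close>

lemma hankel_cone:
  assumes "P (\<lambda>_. 0)" and "\<And>F H. P F \<Longrightarrow> P H \<Longrightarrow> P (\<lambda>x. F x + H x)"
    and "\<And>t H. P H \<Longrightarrow> 0 \<le> t \<Longrightarrow> P (\<lambda>x. t * H x)"
  shows "convex_cone {v \<in> topspace (Euclidean_space d). P (hankel_form m n v)}"
  unfolding convex_cone_iff
  using assms
  by (auto simp: topspace_Euclidean_space hankel_form_add hankel_form_scaleR hankel_form_zero)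
    (simp add: scaleR_fun_def)

text \<open>Closedness in \<open>Euclidean_space d\<close> amounts to closedness in the space of all
  sequences, which is first countable; limits of sequences therefore suffice, and they pass to the
  forms pointwise.\<close>

lemma hankel_closed:
  assumes "\<And>F H. (\<And>j::nat. P (F j)) \<Longrightarrow>
    (\<And>x. x \<in> topspace (Euclidean_space n) \<Longrightarrow> (\<lambda>j. F j x) \<longlonglongrightarrow> H x) \<Longrightarrow> P H"
  shows "closedin (Euclidean_space d) {v \<in> topspace (Euclidean_space d). P (hankel_form m n v)}"
  unfolding closedin_Euclidean_space_iff
proof
  have top: "closed (topspace (Euclidean_space d))"
    using closedin_Euclidean_space_iff by blast
  show "closed {v \<in> topspace (Euclidean_space d). P (hankel_form m n v)}"
    unfolding closed_sequential_limits
  proof (intro allI impI)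
    fix v l
    assume *: "(\<forall>j. v j \<in> {v \<in> topspace (Euclidean_space d). P (hankel_form m n v)}) \<and> v \<longlonglongrightarrow> l"
    then have "l \<in> topspace (Euclidean_space d)"
      using top unfolding closed_sequential_limits by blast
    moreover have "P (hankel_form m n l)"
    proof (rule assms)
      show "P (hankel_form m n (v j))" for j
        using * by simp
      show "(\<lambda>j. hankel_form m n (v j) x) \<longlonglongrightarrow> hankel_form m n l x" for x
        using * by (simp add: hankel_form_tendsto)
    qed
    ultimately show "l \<in> {v \<in> topspace (Euclidean_space d). P (hankel_form m n v)}"
      by simp
  qed
qed blast

lemma PSD_limit:
  assumes "\<And>j. PSD n (H j)"
    and "\<And>x. x \<in> topspace (Euclidean_space n) \<Longrightarrow> (\<lambda>j. H j x) \<longlonglongrightarrow> H' x"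
  shows "PSD n H'"
  using assms unfolding PSD_def by (meson LIMSEQ_le_const)

theorem proposition1:
  fixes m n :: nat
  assumes "m > 0" and "even m" and "n > 0"
  shows "closedin (Euclidean_space ((n - 1) * m + 1)) (HPSD m n) \<and> convex_cone (HPSD m n) \<and>
         closedin (Euclidean_space ((n - 1) * m + 1)) (HSOS m n) \<and> convex_cone (HSOS m n)"
proof (intro conjI)
  show "closedin (Euclidean_space ((n - 1) * m + 1)) (HPSD m n)"
    unfolding HPSD_def hankel_dim_def by (intro hankel_closed) (rule PSD_limit)
  show "convex_cone (HPSD m n)"
    unfolding HPSD_def by (rule hankel_cone) (auto simp: PSD_def)
  show "closedin (Euclidean_space ((n - 1) * m + 1)) (HSOS m n)"
    unfolding HSOS_def hankel_dim_def by (intro hankel_closed) (rule SOS_limit)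
  show "convex_cone (HSOS m n)"
    unfolding HSOS_def by (rule hankel_cone) (auto intro: SOS_zero SOS_add SOS_scale)
qed

end
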